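(* Let $\alpha$ and $\beta$ be smooth functions of $x$, and put $f(x,y,p,q)=\alpha(x)\,p+\alpha'(x)\,y+\beta'(x)$. Let $\mathcal{S}$ be the four-dimensional Riemannian manifold with coordinates $(x,y,p,q)$ and metric $$g=dx^2+(dy-p\,dx)^2+(dp-q\,dx)^2+(dq-f\,dx)^2,$$ i.e. the manifold corresponding to the third-order equation $y'''=\alpha(x)y'+\alpha'(x)y+\beta'(x)$. Let $\widetilde{\mathcal{S}}\subset\mathcal{S}$ be the submanifold corresponding to the linear second-order differential equation $y''=\alpha(x)y+\beta(x)$, i.e. the image of the map $$(x,y,p)\mapsto (x,y,p,\alpha(x)y+\beta(x)).$$ Then $\widetilde{\mathcal{S}}$ is a minimal submanifold of $(\mathcal{S},g)$.
   Context: For a third-order ODE $y'''=f(x,y,y',y'')$, with $p=y'$ and $q=y''$, the corresponding four-dimensional Riemannian manifold has coordinates $(x,y,p,q)$ and metric $g=\sum_{i=1}^4\omega^i\otimes\omega^i$ with $\omega^1=dx$, $\omega^2=dy-p\,dx$, $\omega^3=dp-q\,dx$, $\omega^4=dq-f\,dx$. A three-dimensional submanifold (hypersurface) with the induced metric is called minimal if its mean curvature $H=\frac13\operatorname{tr}\mathcal{A}$ vanishes identically, where $\mathcal{A}$ is the Weingarten (shape) operator in the direction of a unit normal field $\mathbf{n}$, i.e. $\langle\mathcal{A}X,Y\rangle=\langle\mathrm{II}(X,Y),\mathbf{n}\rangle$, with $\mathrm{II}$ the second fundamental form. (The paper calls such a hypersurface a "minimal surface".) *)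

theory Defs
  imports "HOL-Analysis.Analysis"
begin

text \<open>Functions of class \<open>C\<^sup>k\<close> and \<open>C\<^sup>\<infinity>\<close> on a set, which is open wherever these
  notions are used below.\<close>

primrec Ck_on ::
  "nat \<Rightarrow> 'a::euclidean_space set \<Rightarrow> ('a \<Rightarrow> 'b::real_normed_vector) \<Rightarrow> bool" where
  "Ck_on 0 S f \<longleftrightarrow> continuous_on S f"
| "Ck_on (Suc k) S f \<longleftrightarrow> (\<forall>x\<in>S. f differentiable (at x)) \<and>
     (\<forall>v. Ck_on k S (\<lambda>x. frechet_derivative f (at x) v))"

definition smooth_on ::
  "'a::euclidean_space set \<Rightarrow> ('a \<Rightarrow> 'b::real_normed_vector) \<Rightarrow> bool" where
  "smooth_on S f \<longleftrightarrow> (\<forall>k. Ck_on k S f)"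


text \<open>A metric on an open subset of \<open>\<real>\<^sup>n\<close> assigns to a point \<open>z\<close> a bilinear form \<open>g z\<close> on the
  tangent space at \<open>z\<close>, which is identified with \<open>\<real>\<^sup>n\<close> by the coordinate frame.\<close>

type_synonym 'n metric_field = "real^'n \<Rightarrow> real^'n \<Rightarrow> real^'n \<Rightarrow> real"

definition riemannian_metric_on :: "(real^'n) set \<Rightarrow> 'n metric_field \<Rightarrow> bool" where
  "riemannian_metric_on U g \<longleftrightarrow>
     open U \<and>
     (\<forall>z\<in>U. bilinear (g z) \<and> (\<forall>v w. g z v w = g z w v) \<and> (\<forall>v. v \<noteq> 0 \<longrightarrow> 0 < g z v v)) \<and>
     (\<forall>v w. smooth_on U (\<lambda>z. g z v w))"

definition gram_matrix :: "'n metric_field \<Rightarrow> real^'n \<Rightarrow> real^'n^'n" where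
  "gram_matrix g z = (\<chi> i j. g z (axis i 1) (axis j 1))"

definition partial :: "'n \<Rightarrow> (real^'n \<Rightarrow> real) \<Rightarrow> real^'n \<Rightarrow> real" where
  "partial i h z = frechet_derivative h (at z) (axis i 1)"

text \<open>\<open>christoffel g z k i j\<close> is the symbol with upper index \<open>k\<close> and lower indices \<open>i\<close>, \<open>j\<close> of the
  Levi-Civita connection.\<close>

definition christoffel :: "'n metric_field \<Rightarrow> real^'n \<Rightarrow> 'n \<Rightarrow> 'n \<Rightarrow> 'n \<Rightarrow> real" where
  "christoffel g z k i j =
     (1 / 2) * (\<Sum>l\<in>UNIV. matrix_inv (gram_matrix g z) $ k $ l *
       (partial i (\<lambda>z. gram_matrix g z $ j $ l) z +
        partial j (\<lambda>z. gram_matrix g z $ i $ l) z -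
        partial l (\<lambda>z. gram_matrix g z $ i $ j) z))"


text \<open>Geometry of a parametrized submanifold \<open>F\<close>. The tangent space at \<open>F u\<close> is the range of the
  differential, and tangent vectors are represented by their preimages in parameter space.
  \<open>covariant_derivative g F Y u a\<close> is the Levi-Civita derivative at \<open>F u\<close>, in the direction
  \<open>differential F u a\<close>, of a vector field \<open>Y\<close> along \<open>F\<close>.\<close>

abbreviation differential :: "(real^'m \<Rightarrow> real^'n) \<Rightarrow> real^'m \<Rightarrow> real^'m \<Rightarrow> real^'n" where
  "differential F u \<equiv> frechet_derivative F (at u)"

definition covariant_derivative ::
  "'n metric_field \<Rightarrow> (real^'m \<Rightarrow> real^'n) \<Rightarrow> (real^'m \<Rightarrow> real^'n) \<Rightarrow> real^'m \<Rightarrow> real^'m \<Rightarrow> real^'n"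
where
  "covariant_derivative g F Y u a =
     differential Y u a +
     (\<chi> k. \<Sum>i\<in>UNIV. \<Sum>j\<in>UNIV. christoffel g (F u) k i j * differential F u a $ i * Y u $ j)"

definition is_normal ::
  "'n metric_field \<Rightarrow> (real^'m \<Rightarrow> real^'n) \<Rightarrow> real^'m \<Rightarrow> real^'n \<Rightarrow> bool" where
  "is_normal g F u w \<longleftrightarrow> (\<forall>a. g (F u) w (differential F u a) = 0)"

definition unit_normal ::
  "'n metric_field \<Rightarrow> (real^'m \<Rightarrow> real^'n) \<Rightarrow> real^'m \<Rightarrow> real^'n \<Rightarrow> bool" where
  "unit_normal g F u \<nu> \<longleftrightarrow> is_normal g F u \<nu> \<and> g (F u) \<nu> \<nu> = 1"

definition normal_part ::
  "'n metric_field \<Rightarrow> (real^'m \<Rightarrow> real^'n) \<Rightarrow> real^'m \<Rightarrow> real^'n \<Rightarrow> real^'n" where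
  "normal_part g F u v = (THE w. is_normal g F u w \<and> v - w \<in> range (differential F u))"

text \<open>\<open>second_fundamental_form g F u a b\<close> is the normal part of the derivative, in the direction
  \<open>differential F u a\<close>, of the tangent field \<open>u \<mapsto> differential F u b\<close>.\<close>

definition second_fundamental_form ::
  "'n metric_field \<Rightarrow> (real^'m \<Rightarrow> real^'n) \<Rightarrow> real^'m \<Rightarrow> real^'m \<Rightarrow> real^'m \<Rightarrow> real^'n" where
  "second_fundamental_form g F u a b =
     normal_part g F u (covariant_derivative g F (\<lambda>u. differential F u b) u a)"

definition shape_operator ::
  "'n metric_field \<Rightarrow> (real^'m \<Rightarrow> real^'n) \<Rightarrow> real^'m \<Rightarrow> real^'n \<Rightarrow> real^'m \<Rightarrow> real^'m" where
  "shape_operator g F u \<nu> =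
     (THE A. linear A \<and>
       (\<forall>a b. g (F u) (differential F u (A a)) (differential F u b) =
                g (F u) (second_fundamental_form g F u a b) \<nu>))"

definition mean_curvature ::
  "4 metric_field \<Rightarrow> (real^3 \<Rightarrow> real^4) \<Rightarrow> real^3 \<Rightarrow> real^4 \<Rightarrow> real" where
  "mean_curvature g F u \<nu> = (1 / 3) * trace (matrix (shape_operator g F u \<nu>))"

definition local_parametrization ::
  "(real^4) set \<Rightarrow> (real^3) set \<Rightarrow> (real^3 \<Rightarrow> real^4) \<Rightarrow> bool" where
  "local_parametrization M V F \<longleftrightarrow>
     open V \<and> smooth_on V F \<and> (\<forall>u\<in>V. inj (differential F u)) \<and>
     openin (top_of_set M) (F ` V) \<and> (\<exists>G. homeomorphism V (F ` V) F G)"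

text \<open>\<open>M\<close> is an embedded hypersurface of the Riemannian manifold \<open>(U, g)\<close> whose mean curvature
  vanishes at every point. The value of the mean curvature at a point does not depend on the
  parametrization, and changing the unit normal to its opposite only changes the sign.\<close>

definition minimal_hypersurface ::
  "(real^4) set \<Rightarrow> 4 metric_field \<Rightarrow> (real^4) set \<Rightarrow> bool" where
  "minimal_hypersurface U g M \<longleftrightarrow>
     riemannian_metric_on U g \<and> M \<subseteq> U \<and>
     (\<forall>z\<in>M. \<exists>V F. local_parametrization M V F \<and> z \<in> F ` V \<and>
        (\<forall>u\<in>V. \<forall>\<nu>. unit_normal g F u \<nu> \<longrightarrow> mean_curvature g F u \<nu> = 0))"


text \<open>The coframe and the metric of the equation \<open>y''' = f (x, y, y', y'')\<close>. The components of a
  point \<open>z\<close> are the coordinates \<open>(x, y, p, q)\<close>, and \<open>v $ 1, \<dots>, v $ 4\<close> are \<open>dx, dy, dp, dq\<close> of a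
  tangent vector \<open>v\<close>.\<close>

definition ode_coframe ::
  "(real \<Rightarrow> real \<Rightarrow> real \<Rightarrow> real \<Rightarrow> real) \<Rightarrow> real^4 \<Rightarrow> real^4 \<Rightarrow> real^4" where
  "ode_coframe f z v =
     vector [v $ 1,
             v $ 2 - z $ 3 * v $ 1,
             v $ 3 - z $ 4 * v $ 1,
             v $ 4 - f (z $ 1) (z $ 2) (z $ 3) (z $ 4) * v $ 1]"

definition ode_metric :: "(real \<Rightarrow> real \<Rightarrow> real \<Rightarrow> real \<Rightarrow> real) \<Rightarrow> 4 metric_field" where
  "ode_metric f z v w = (\<Sum>i\<in>UNIV. ode_coframe f z v $ i * ode_coframe f z w $ i)"

end

theory Submission imports Defs begin

text \<open>
Write \<open>\<omega>\<^sup>1, \<dots>, \<omega>\<^sup>4\<close> for the orthonormal coframe and \<open>e\<^sub>1, \<dots>, e\<^sub>4\<close> for the dual frame, so that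
\<open>e\<^sub>1 = \<partial>\<^sub>x + p \<partial>\<^sub>y + q \<partial>\<^sub>p + f \<partial>\<^sub>q\<close>, \<open>e\<^sub>2 = \<partial>\<^sub>y\<close>, \<open>e\<^sub>3 = \<partial>\<^sub>p\<close>, \<open>e\<^sub>4 = \<partial>\<^sub>q\<close>. The function
\<open>f = \<alpha> p + \<alpha>' y + \<beta>'\<close> is the derivative of \<open>\<alpha> y + \<beta>\<close> along the solutions of the equation, so
\<open>\<omega>\<^sup>4\<close> restricts to \<open>\<alpha> \<omega>\<^sup>2\<close> on the hypersurface \<open>q = \<alpha> y + \<beta>\<close>. Its tangent space is therefore
spanned by the orthogonal vectors \<open>e\<^sub>1\<close>, \<open>e\<^sub>2 + \<alpha> e\<^sub>4\<close>, \<open>e\<^sub>3\<close>, and its normal line by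
\<open>e\<^sub>4 - \<alpha> e\<^sub>2\<close>.

Each of these three directions is asymptotic: the second fundamental form of the hypersurface
vanishes on the pair of the direction with itself (\<open>solution_frame_asymptotic\<close>). The integral curves of \<open>e\<^sub>1\<close> are geodesics of the ambient space,
because \<open>\<omega>\<^sup>1 = dx\<close> is closed: brackets with \<open>e\<^sub>1\<close> have no \<open>e\<^sub>1\<close> component. The other two directions
are tangent to the slices \<open>x = const\<close>, on which the metric is the flat metric
\<open>dy\<^sup>2 + dp\<^sup>2 + dq\<^sup>2\<close> and the hypersurface is the plane \<open>q = \<alpha> y + \<beta>\<close>; the normal direction is tangent
to these slices as well. The mean curvature is a third of the trace of the shape operator, and the
trace is the sum of the normalized diagonal entries of the second fundamental form in any orthogonal
frame (\<open>mean_curvature_orthogonal_frame\<close>), hence zero.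

In coordinates, the inverse of the Gram matrix in the Christoffel symbols disappears as soon as the
covariant derivative is paired with the normal by the metric: what remains is the Koszul formula for
constant vector fields (\<open>connection_term_koszul\<close>), which involves only first derivatives of the
metric. For the metric of an equation these follow from the derivatives of the coframe
(\<open>metric_derivative_ode_metric\<close>).
\<close>

section \<open>Calculus of \<open>C\<^sup>k\<close> functions\<close>

lemma Ck_on_cong:
  assumes "open S" and "\<And>x. x \<in> S \<Longrightarrow> f x = g x"
  shows "Ck_on k S f \<longleftrightarrow> Ck_on k S g"
  using assms(2)
proof (induction k arbitrary: f g)
  case 0
  then show ?case by (simp cong: continuous_on_cong)
next
  case (Suc k)
  have der: "(f has_derivative D) (at x) \<longleftrightarrow> (g has_derivative D) (at x)" if "x \<in> S" for x D
    using has_derivative_transform_within_open[OF _ \<open>open S\<close> that] Suc.prems by metis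
  then have "f differentiable (at x) \<longleftrightarrow> g differentiable (at x)" if "x \<in> S" for x
    using that by (simp add: differentiable_def)
  moreover have "frechet_derivative f (at x) = frechet_derivative g (at x)" if "x \<in> S" for x
    using that der by (simp add: frechet_derivative_def)
  moreover have "Ck_on k S (\<lambda>x. frechet_derivative f (at x) v) \<longleftrightarrow>
      Ck_on k S (\<lambda>x. frechet_derivative g (at x) v)" for v
    by (rule Suc.IH) (simp add: calculation(2))
  ultimately show ?case
    by simp
qed

text \<open>The derivative in the definition of \<open>Ck_on\<close> is a fixed choice; this rule admits any formula for
  it, which is how the inductions on \<open>k\<close> below proceed.\<close>

lemma Ck_on_SucI:
  assumes "open S"
    and "\<And>x. x \<in> S \<Longrightarrow> (f has_derivative D x) (at x)"
    and "\<And>v. Ck_on k S (\<lambda>x. D x v)"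
  shows "Ck_on (Suc k) S f"
proof -
  have "frechet_derivative f (at x) = D x" if "x \<in> S" for x
    using frechet_derivative_at[OF assms(2)[OF that]] by simp
  then have "Ck_on k S (\<lambda>x. frechet_derivative f (at x) v)" for v
    using assms(3)[of v] Ck_on_cong[OF assms(1), of "\<lambda>x. frechet_derivative f (at x) v" "\<lambda>x. D x v"]
    by simp
  then show ?thesis
    using assms(2) by (auto simp: differentiable_def)
qed

lemma Ck_on_SucD:
  assumes "Ck_on (Suc k) S f"
  shows "x \<in> S \<Longrightarrow> (f has_derivative frechet_derivative f (at x)) (at x)"
    and "Ck_on k S (\<lambda>x. frechet_derivative f (at x) v)"
  using assms by (simp_all add: frechet_derivative_works)

lemma Ck_on_imp_continuous_on: "Ck_on k S f \<Longrightarrow> continuous_on S f"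
  by (cases k) (auto intro!: continuous_at_imp_continuous_on differentiable_imp_continuous_within)

lemma Ck_on_Suc_imp: "Ck_on (Suc k) S f \<Longrightarrow> Ck_on k S f"
proof (induction k arbitrary: f)
  case 0
  then show ?case using Ck_on_imp_continuous_on[of "Suc 0" S f] by simp
next
  case (Suc k)
  have "Ck_on k S (\<lambda>x. frechet_derivative f (at x) v)" for v
    by (rule Suc.IH[OF Ck_on_SucD(2)[OF Suc.prems]])
  then show ?case using Ck_on_SucD(1)[OF Suc.prems] by (auto simp: differentiable_def)
qed

lemma Ck_on_const: "open S \<Longrightarrow> Ck_on k S (\<lambda>x. c)"
proof (induction k arbitrary: c)
  case 0
  then show ?case by simp
next
  case (Suc k)
  show ?case
    by (rule Ck_on_SucI[OF Suc.prems has_derivative_const Suc.IH[OF Suc.prems]])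
qed

lemma Ck_on_linear_compose:
  assumes "open S" "bounded_linear L" "Ck_on k S f"
  shows "Ck_on k S (\<lambda>x. L (f x))"
  using assms(3)
proof (induction k arbitrary: f)
  case 0
  then show ?case
    using bounded_linear.continuous_on[OF assms(2), of S f] by simp
next
  case (Suc k)
  show ?case
  proof (rule Ck_on_SucI[OF assms(1)])
    show "((\<lambda>x. L (f x)) has_derivative (\<lambda>v. L (frechet_derivative f (at x) v))) (at x)"
      if "x \<in> S" for x
      using bounded_linear.has_derivative[OF assms(2) Ck_on_SucD(1)[OF Suc.prems that]] .
    show "Ck_on k S (\<lambda>x. L (frechet_derivative f (at x) v))" for v
      by (rule Suc.IH[OF Ck_on_SucD(2)[OF Suc.prems]])
  qed
qed

lemma Ck_on_linear:
  assumes "open S" "bounded_linear L" shows "Ck_on k S L"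
proof (cases k)
  case 0
  then show ?thesis using assms by (simp add: linear_continuous_on)
next
  case (Suc n)
  then show ?thesis
    using Ck_on_SucI[OF assms(1) bounded_linear_imp_has_derivative[OF assms(2)] Ck_on_const[OF assms(1)]]
    by blast
qed

lemma Ck_on_add:
  assumes "open S" "Ck_on k S f" "Ck_on k S g"
  shows "Ck_on k S (\<lambda>x. f x + g x)"
  using assms(2,3)
proof (induction k arbitrary: f g)
  case 0
  then show ?case by (simp add: continuous_on_add)
next
  case (Suc k)
  show ?case
  proof (rule Ck_on_SucI[OF assms(1)])
    show "((\<lambda>x. f x + g x) has_derivative
        (\<lambda>v. frechet_derivative f (at x) v + frechet_derivative g (at x) v)) (at x)"
      if "x \<in> S" for x
      by (rule has_derivative_add[OF Suc.prems[THEN Ck_on_SucD(1), OF that]])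
  qed (rule Suc.IH[OF Suc.prems[THEN Ck_on_SucD(2)]])
qed

lemma Ck_on_diff:
  assumes "open S" "Ck_on k S f" "Ck_on k S g"
  shows "Ck_on k S (\<lambda>x. f x - g x)"
  using Ck_on_add[OF assms(1,2) Ck_on_linear_compose[OF assms(1) bounded_linear_minus[OF bounded_linear_ident] assms(3)]]
  by simp

lemma Ck_on_mult:
  fixes f g :: "'a::euclidean_space \<Rightarrow> real"
  assumes "open S" "Ck_on k S f" "Ck_on k S g"
  shows "Ck_on k S (\<lambda>x. f x * g x)"
  using assms(2,3)
proof (induction k arbitrary: f g)
  case 0
  then show ?case by (simp add: continuous_on_mult)
next
  case (Suc k)
  show ?case
  proof (rule Ck_on_SucI[OF assms(1)])
    show "((\<lambda>x. f x * g x) has_derivative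
        (\<lambda>v. f x * frechet_derivative g (at x) v + frechet_derivative f (at x) v * g x)) (at x)"
      if "x \<in> S" for x
      by (rule has_derivative_mult[OF Suc.prems[THEN Ck_on_SucD(1), OF that]])
    show "Ck_on k S (\<lambda>x. f x * frechet_derivative g (at x) v + frechet_derivative f (at x) v * g x)"
      for v
      using Suc.prems
      by (intro Ck_on_add[OF assms(1)] Suc.IH) (simp_all add: Ck_on_Suc_imp del: Ck_on.simps(2) add: Ck_on_SucD(2))
  qed
qed

lemma frechet_derivative_real:
  fixes f :: "real \<Rightarrow> real"
  assumes "f differentiable (at x)"
  shows "frechet_derivative f (at x) v = deriv f x * v"
proof -
  have "(f has_derivative (\<lambda>v. deriv f x * v)) (at x)"
    using assms
    by (metis DERIV_deriv_iff_real_differentiable has_field_derivative_imp_has_derivative)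
  then show ?thesis
    using frechet_derivative_at by metis
qed

lemma Ck_on_deriv:
  fixes f :: "real \<Rightarrow> real"
  assumes "open S" "Ck_on (Suc k) S f"
  shows "Ck_on k S (deriv f)"
  using Ck_on_SucD(2)[OF assms(2), of 1] assms(2)
    Ck_on_cong[OF assms(1), of "\<lambda>x. frechet_derivative f (at x) 1" "deriv f"]
  by (simp add: frechet_derivative_real)

text \<open>A chain rule restricted to linear inner functions suffices, since \<open>\<alpha>\<close> and \<open>\<beta>\<close> are only composed
  with the coordinate \<open>x\<close>. The derivative is again such a composition times a constant, so the
  induction on \<open>k\<close> closes up.\<close>

lemma Ck_on_compose_linear:
  fixes f :: "real \<Rightarrow> real" and L :: "'a::euclidean_space \<Rightarrow> real"
  assumes "open S" "bounded_linear L" "Ck_on k S f"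
  shows "Ck_on k {z. L z \<in> S} (\<lambda>z. f (L z))"
proof -
  have op: "open {z. L z \<in> S}"
    using open_vimage[OF assms(1) linear_continuous_on[OF assms(2)]] by (simp add: vimage_def)
  show ?thesis
    using assms(3)
  proof (induction k arbitrary: f)
    case 0
    then show ?case
      using continuous_on_compose2[of S f "{z. L z \<in> S}" L] linear_continuous_on[OF assms(2)] by auto
  next
    case (Suc k)
    show ?case
    proof (rule Ck_on_SucI[OF op])
      show "((\<lambda>z. f (L z)) has_derivative (\<lambda>v. deriv f (L z) * L v)) (at z)"
        if "z \<in> {z. L z \<in> S}" for z
      proof -
        have "(f has_derivative (\<lambda>v. deriv f (L z) * v)) (at (L z))"
          using Suc.prems that
          by (simp add: DERIV_deriv_iff_real_differentiable has_field_derivative_imp_has_derivative)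
        then show ?thesis
          using has_derivative_compose[OF bounded_linear_imp_has_derivative[OF assms(2)]] by blast
      qed
      show "Ck_on k {z. L z \<in> S} (\<lambda>z. deriv f (L z) * L v)" for v
        by (intro Ck_on_mult Ck_on_const op Suc.IH Ck_on_deriv[OF assms(1) Suc.prems])
    qed
  qed
qed

lemma smooth_on_deriv:
  fixes \<gamma> :: "real \<Rightarrow> real"
  assumes "open I" "smooth_on I \<gamma>"
  shows "smooth_on I (deriv \<gamma>)"
  using assms Ck_on_deriv unfolding smooth_on_def by blast

lemma smooth_on_coordinate:
  fixes \<gamma> :: "real \<Rightarrow> real"
  assumes "open I" "smooth_on I \<gamma>"
  shows "smooth_on {z :: real^'n. z $ i \<in> I} (\<lambda>z. \<gamma> (z $ i))"
  using assms Ck_on_compose_linear[OF _ bounded_linear_vec_nth] unfolding smooth_on_def by blast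

lemmas has_derivative_nth = bounded_linear_imp_has_derivative[OF bounded_linear_vec_nth]

lemma has_derivative_coordinate:
  fixes \<gamma> :: "real \<Rightarrow> real"
  assumes "smooth_on I \<gamma>" "u $ i \<in> I"
  shows "((\<lambda>u :: real^'n. \<gamma> (u $ i)) has_derivative (\<lambda>a. deriv \<gamma> (u $ i) * a $ i)) (at u)"
proof -
  have "Ck_on (Suc 0) I \<gamma>"
    using assms(1) by (auto simp: smooth_on_def)
  then have "(\<gamma> has_derivative (\<lambda>v. deriv \<gamma> (u $ i) * v)) (at (u $ i))"
    using assms(2)
    by (simp add: DERIV_deriv_iff_real_differentiable has_field_derivative_imp_has_derivative)
  then show ?thesis
    using has_derivative_compose[OF has_derivative_nth] by blast
qed

lemma open_coordinate: "open I \<Longrightarrow> open {z :: real^'n. z $ i \<in> I}"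
  using open_vimage[of I "\<lambda>z :: real^'n. z $ i"] by (simp add: vimage_def continuous_on_component)

section \<open>Positive definite forms and traces\<close>

lemma linear_basis_expand:
  fixes L :: "real^'n \<Rightarrow> real"
  assumes "linear L"
  shows "L x = (\<Sum>k\<in>UNIV. x $ k * L (axis k 1))"
proof -
  have "L (\<Sum>k\<in>UNIV. x $ k *\<^sub>R axis k 1) = (\<Sum>k\<in>UNIV. x $ k * L (axis k 1))"
    by (simp add: linear_sum[OF assms] linear_cmul[OF assms])
  then show ?thesis
    using basis_expansion[of x] by (simp add: scalar_mult_eq_scaleR)
qed

lemma bilinear_expand:
  fixes h :: "real^'n \<Rightarrow> real^'n \<Rightarrow> real"
  assumes "bilinear h"
  shows "h v w = (\<Sum>j\<in>UNIV. \<Sum>l\<in>UNIV. v $ j * w $ l * h (axis j 1) (axis l 1))"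
proof -
  have "linear (\<lambda>v. h v w)" and "linear (h v)" for v
    using assms by (simp_all add: bilinear_def)
  then have "h v w = (\<Sum>j\<in>UNIV. v $ j * (\<Sum>l\<in>UNIV. w $ l * h (axis j 1) (axis l 1)))"
    using linear_basis_expand[of "\<lambda>v. h v w" v] linear_basis_expand[of "h _" w] by simp
  then show ?thesis
    by (simp add: sum_distrib_left mult.assoc)
qed

definition positive_form :: "(real^'n \<Rightarrow> real^'n \<Rightarrow> real) \<Rightarrow> bool" where
  "positive_form h \<longleftrightarrow> bilinear h \<and> (\<forall>v w. h v w = h w v) \<and> (\<forall>v. v \<noteq> 0 \<longrightarrow> 0 < h v v)"

lemma positive_formD:
  assumes "positive_form h"
  shows "bilinear h" and "h v w = h w v" and "v \<noteq> 0 \<Longrightarrow> 0 < h v v" and "h v v = 0 \<Longrightarrow> v = 0"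
  proof -
  show "bilinear h" and "h v w = h w v" and "v \<noteq> 0 \<Longrightarrow> 0 < h v v"
    using assms by (simp_all add: positive_form_def)
  show "h v v = 0 \<Longrightarrow> v = 0"
    using assms unfolding positive_form_def by force
qed

lemma positive_form_eqI:
  assumes h: "positive_form h" and eq: "\<And>b. h x b = h y b"
  shows "x = y"
proof -
  have "h (x - y) (x - y) = 0"
    by (simp add: bilinear_lsub[OF positive_formD(1)[OF h]] eq)
  then show ?thesis using positive_formD(4)[OF h] by fastforce
qed

text \<open>The functional is determined by its values on the standard basis. The map from vectors to the values
  of their functionals on the basis is linear, and injective by definiteness, so it is surjective by
  equality of dimensions.\<close>

lemma positive_form_represent:
  fixes h :: "real^'n \<Rightarrow> real^'n \<Rightarrow> real"
  assumes h: "positive_form h" and L: "linear L"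
  shows "\<exists>x. \<forall>b. h x b = L b"
proof -
  note bil = positive_formD(1)[OF h]
  have lin: "linear (\<lambda>b. h x b)" for x
    using bil by (simp add: bilinear_def)
  define \<Phi> where "\<Phi> x = (\<chi> i. h x (axis i 1))" for x
  have ext: "L' = L''" if "linear L'" "linear L''" "\<And>i. L' (axis i 1) = L'' (axis i 1)"
    for L' L'' :: "real^'n \<Rightarrow> real"
    using that by (intro linear_eq_stdbasis) (auto simp: Basis_vec_def)
  have "linear \<Phi>"
    by (rule linearI) (simp_all add: \<Phi>_def vec_eq_iff bilinear_ladd[OF bil] bilinear_lmul[OF bil])
  moreover have "inj \<Phi>"
  proof (rule injI)
    fix x y assume "\<Phi> x = \<Phi> y"
    then have "h x (axis i 1) = h y (axis i 1)" for i
      by (simp add: \<Phi>_def vec_eq_iff)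
    then have "(\<lambda>b. h x b) = (\<lambda>b. h y b)"
      by (intro ext lin)
    then show "x = y"
      by (intro positive_form_eqI[OF h]) meson
  qed
  ultimately have "surj \<Phi>"
    by (simp add: linear_injective_imp_surjective)
  then obtain x where "\<Phi> x = (\<chi> i. L (axis i 1))"
    by (metis surjD)
  then have "h x (axis i 1) = L (axis i 1)" for i
    by (simp add: \<Phi>_def vec_eq_iff)
  then have "(\<lambda>b. h x b) = L"
    by (intro ext lin L)
  then show ?thesis by metis
qed

text \<open>This makes the definite description in \<open>shape_operator\<close> meaningful: the shape operator is the
  operator that represents the scalar second fundamental form with respect to the induced metric.\<close>

lemma positive_form_represent_bilinear:
  fixes h :: "real^'n \<Rightarrow> real^'n \<Rightarrow> real"
  assumes h: "positive_form h" and B: "bilinear B"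
  shows "\<exists>!A. linear A \<and> (\<forall>a b. h (A a) b = B a b)"
proof -
  note bil = positive_formD(1)[OF h]
  have "\<exists>x. \<forall>b. h x b = B a b" for a
    by (rule positive_form_represent[OF h]) (use B in \<open>simp add: bilinear_def\<close>)
  then obtain A where A: "h (A a) b = B a b" for a b
    by metis
  have "linear A"
    by (rule linearI; rule positive_form_eqI[OF h])
      (simp_all add: A bilinear_ladd[OF bil] bilinear_lmul[OF bil] bilinear_ladd[OF B] bilinear_lmul[OF B])
  moreover have "A' = A" if "\<forall>a b. h (A' a) b = B a b" for A'
    using that A by (auto intro!: ext positive_form_eqI[OF h])
  ultimately show ?thesis using A by blast
qed

text \<open>Let \<open>P\<close> have the frame as its columns and let \<open>Q\<close> compute the coefficients in the frame. Orthogonality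
  says \<open>Q P = 1\<close>, so \<open>P Q = 1\<close> and the trace of \<open>A\<close> is the trace of \<open>Q A P\<close>, whose diagonal entries are
  the displayed quotients.\<close>

lemma trace_orthogonal_frame:
  fixes h :: "real^'n \<Rightarrow> real^'n \<Rightarrow> real" and T :: "'n \<Rightarrow> real^'n"
  assumes h: "positive_form h" and A: "linear A"
    and T: "\<And>i. T i \<noteq> 0" "\<And>i j. i \<noteq> j \<Longrightarrow> h (T i) (T j) = 0"
  shows "trace (matrix A) = (\<Sum>i\<in>UNIV. h (A (T i)) (T i) / h (T i) (T i))"
proof -
  note bil = positive_formD(1)[OF h]
  define P :: "real^'n^'n" where "P = (\<chi> i j. T j $ i)"
  define Q :: "real^'n^'n" where "Q = (\<chi> i j. h (axis j 1) (T i) / h (T i) (T i))"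
  have Q: "(\<Sum>k\<in>UNIV. Q $ i $ k * a $ k) = h a (T i) / h (T i) (T i)" for i a
  proof -
    have "linear (\<lambda>a. h a (T i))"
      using bil by (simp add: bilinear_def)
    from linear_basis_expand[OF this, of a] show ?thesis
      by (simp add: Q_def sum_divide_distrib mult.commute)
  qed
  have pos: "h (T i) (T i) \<noteq> 0" for i
    using positive_formD(3)[OF h T(1)] by (metis less_irrefl)
  have "Q ** P = mat 1"
    using pos by (auto simp: vec_eq_iff matrix_matrix_mult_def P_def Q mat_def T(2))
  then have "P ** Q = mat 1"
    by (simp add: matrix_left_right_inverse)
  then have "trace (matrix A) = trace (matrix A ** P ** Q)"
    by (simp add: matrix_mul_assoc[symmetric])
  also have "\<dots> = trace (Q ** (matrix A ** P))"
    by (rule trace_mul_sym)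
  also have "\<dots> = (\<Sum>i\<in>UNIV. h (A (T i)) (T i) / h (T i) (T i))"
  proof -
    have "(matrix A ** P) $ k $ i = A (T i) $ k" for k i
    proof -
      have "A (T i) = matrix A *v T i"
        using A by (simp add: matrix_works)
      then show ?thesis
        by (simp add: matrix_matrix_mult_def matrix_vector_mult_def P_def)
    qed
    then show ?thesis
      by (simp add: trace_def matrix_matrix_mult_def[of Q] Q)
  qed
  finally show ?thesis .
qed

section \<open>The Levi-Civita connection in coordinates\<close>

lemma riemannian_metric_onD:
  assumes "riemannian_metric_on U g"
  shows "open U" and "z \<in> U \<Longrightarrow> positive_form (g z)"
    and "z \<in> U \<Longrightarrow> (\<lambda>z. g z v w) differentiable (at z)"
proof -
  show "open U" and "z \<in> U \<Longrightarrow> positive_form (g z)"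
    using assms by (simp_all add: riemannian_metric_on_def positive_form_def)
  have "Ck_on (Suc 0) U (\<lambda>z. g z v w)"
    using assms unfolding riemannian_metric_on_def smooth_on_def by blast
  then show "z \<in> U \<Longrightarrow> (\<lambda>z. g z v w) differentiable (at z)"
    by simp
qed

definition metric_derivative ::
  "'n metric_field \<Rightarrow> real^'n \<Rightarrow> real^'n \<Rightarrow> real^'n \<Rightarrow> real^'n \<Rightarrow> real" where
  "metric_derivative g z X Y W = frechet_derivative (\<lambda>z. g z Y W) (at z) X"

text \<open>The components of this trilinear form are the partial derivatives from which the Christoffel symbols
  are built.\<close>

lemma metric_derivative_expand:
  fixes g :: "'n::finite metric_field"
  assumes g: "riemannian_metric_on U g" and z: "z \<in> U"
  shows "metric_derivative g z X Y W =
    (\<Sum>i\<in>UNIV. \<Sum>j\<in>UNIV. \<Sum>l\<in>UNIV.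
       X $ i * Y $ j * W $ l * partial i (\<lambda>z. gram_matrix g z $ j $ l) z)"
proof -
  let ?G = "\<lambda>j l z. g z (axis j 1) (axis l 1)"
  have G: "(?G j l has_derivative frechet_derivative (?G j l) (at z)) (at z)" for j l
    using riemannian_metric_onD(3)[OF g z] by (simp add: frechet_derivative_works)
  have "((\<lambda>z. \<Sum>j\<in>UNIV. \<Sum>l\<in>UNIV. Y $ j * W $ l * ?G j l z) has_derivative
      (\<lambda>X. \<Sum>j\<in>UNIV. \<Sum>l\<in>UNIV. Y $ j * W $ l * frechet_derivative (?G j l) (at z) X)) (at z)"
    by (intro has_derivative_sum has_derivative_mult_right G)
  then have "((\<lambda>z. g z Y W) has_derivative
      (\<lambda>X. \<Sum>j\<in>UNIV. \<Sum>l\<in>UNIV. Y $ j * W $ l * frechet_derivative (?G j l) (at z) X)) (at z)"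
    by (rule has_derivative_transform_within_open[OF _ riemannian_metric_onD(1)[OF g] z])
      (simp add: bilinear_expand[OF positive_formD(1)[OF riemannian_metric_onD(2)[OF g]], of _ Y W])
  then have "metric_derivative g z X Y W =
      (\<Sum>j\<in>UNIV. \<Sum>l\<in>UNIV. Y $ j * W $ l * frechet_derivative (?G j l) (at z) X)"
    unfolding metric_derivative_def by (rule fun_cong[OF frechet_derivative_at[symmetric]])
  also have "\<dots> = (\<Sum>j\<in>UNIV. \<Sum>l\<in>UNIV. \<Sum>i\<in>UNIV.
      X $ i * Y $ j * W $ l * frechet_derivative (?G j l) (at z) (axis i 1))"
  proof (intro sum.cong refl)
    fix j l
    have lin: "linear (frechet_derivative (?G j l) (at z))"
      by (rule has_derivative_linear[OF G])
    show "Y $ j * W $ l * frechet_derivative (?G j l) (at z) X = (\<Sum>i\<in>UNIV.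
        X $ i * Y $ j * W $ l * frechet_derivative (?G j l) (at z) (axis i 1))"
      by (subst linear_basis_expand[OF lin]) (simp add: sum_distrib_left mult_ac)
  qed
  also have "\<dots> = (\<Sum>j\<in>UNIV. \<Sum>i\<in>UNIV. \<Sum>l\<in>UNIV.
      X $ i * Y $ j * W $ l * frechet_derivative (?G j l) (at z) (axis i 1))"
    by (intro sum.cong refl sum.swap)
  also have "\<dots> = (\<Sum>i\<in>UNIV. \<Sum>j\<in>UNIV. \<Sum>l\<in>UNIV.
      X $ i * Y $ j * W $ l * frechet_derivative (?G j l) (at z) (axis i 1))"
    by (rule sum.swap)
  finally show ?thesis
    by (simp add: partial_def gram_matrix_def)
qed

text \<open>The Levi-Civita derivative, in direction \<open>X\<close>, of the constant vector field \<open>Y\<close>.\<close>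

definition connection_term ::
  "'n metric_field \<Rightarrow> real^'n \<Rightarrow> real^'n \<Rightarrow> real^'n \<Rightarrow> real^'n" where
  "connection_term g z X Y = (\<chi> k. \<Sum>i\<in>UNIV. \<Sum>j\<in>UNIV. christoffel g z k i j * X $ i * Y $ j)"

lemma gram_matrix_inverse:
  fixes g :: "'n::finite metric_field"
  assumes "positive_form (g z)"
  shows "gram_matrix g z ** matrix_inv (gram_matrix g z) = mat 1"
    and "inner W (gram_matrix g z *v V) = g z V W"
proof -
  show inn: "inner W (gram_matrix g z *v V) = g z V W" for V W
    by (subst positive_formD(2)[OF assms], subst bilinear_expand[OF positive_formD(1)[OF assms]])
      (simp add: inner_vec_def matrix_vector_mult_def gram_matrix_def sum_distrib_left mult_ac)
  have "x = 0" if "gram_matrix g z *v x = 0" for x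
    using inn[of x x] that positive_formD(4)[OF assms] by simp
  then have "invertible (gram_matrix g z)"
    unfolding invertible_left_inverse matrix_left_invertible_ker by blast
  then have "\<exists>A. gram_matrix g z ** A = mat 1 \<and> A ** gram_matrix g z = mat 1"
    by (simp add: invertible_def)
  then show "gram_matrix g z ** matrix_inv (gram_matrix g z) = mat 1"
    unfolding matrix_inv_def by (metis (mono_tags, lifting) someI_ex)
qed

text \<open>Constant vector fields commute, so the bracket terms of the Koszul formula are absent. Pairing with
  \<open>W\<close> multiplies the vector of Christoffel terms by the Gram matrix, which cancels the inverse Gram
  matrix in the symbols.\<close>

lemma connection_term_koszul:
  fixes g :: "'n::finite metric_field"
  assumes g: "riemannian_metric_on U g" and z: "z \<in> U"
  shows "g z (connection_term g z X Y) W =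
    (metric_derivative g z X Y W + metric_derivative g z Y X W - metric_derivative g z W X Y) / 2"
proof -
  let ?G = "gram_matrix g z"
  let ?d = "\<lambda>i j l. partial i (\<lambda>z. gram_matrix g z $ j $ l) z"
  define c where "c i j l = ?d i j l + ?d j i l - ?d l i j" for i j l
  define v :: "real^'n" where "v = (\<chi> l. (1 / 2) * (\<Sum>i\<in>UNIV. \<Sum>j\<in>UNIV. c i j l * X $ i * Y $ j))"
  have "connection_term g z X Y $ k = (matrix_inv ?G *v v) $ k" for k
  proof -
    have "connection_term g z X Y $ k = (\<Sum>i\<in>UNIV. \<Sum>j\<in>UNIV. \<Sum>l\<in>UNIV.
        matrix_inv ?G $ k $ l * ((1 / 2) * (c i j l * X $ i * Y $ j)))"
      by (simp add: connection_term_def christoffel_def c_def sum_distrib_left sum_distrib_right mult_ac)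
    also have "\<dots> = (\<Sum>i\<in>UNIV. \<Sum>l\<in>UNIV. \<Sum>j\<in>UNIV.
        matrix_inv ?G $ k $ l * ((1 / 2) * (c i j l * X $ i * Y $ j)))"
      by (intro sum.cong refl sum.swap)
    also have "\<dots> = (\<Sum>l\<in>UNIV. \<Sum>i\<in>UNIV. \<Sum>j\<in>UNIV.
        matrix_inv ?G $ k $ l * ((1 / 2) * (c i j l * X $ i * Y $ j)))"
      by (rule sum.swap)
    finally show ?thesis
      by (simp add: matrix_vector_mult_def v_def sum_distrib_left)
  qed
  then have "connection_term g z X Y = matrix_inv ?G *v v"
    by (simp add: vec_eq_iff)
  then have "?G *v connection_term g z X Y = v"
    by (simp add: matrix_vector_mul_assoc gram_matrix_inverse(1)[of g z, OF riemannian_metric_onD(2)[OF g z]])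
  then have "g z (connection_term g z X Y) W = inner W v"
    using gram_matrix_inverse(2)[of g z, OF riemannian_metric_onD(2)[OF g z], of W] by metis
  also have "\<dots> = (\<Sum>l\<in>UNIV. \<Sum>i\<in>UNIV. \<Sum>j\<in>UNIV. X $ i * Y $ j * W $ l * c i j l) / 2"
    by (simp add: inner_vec_def v_def sum_distrib_left sum_divide_distrib mult_ac)
  also have "(\<Sum>l\<in>UNIV. \<Sum>i\<in>UNIV. \<Sum>j\<in>UNIV. X $ i * Y $ j * W $ l * c i j l) =
      (\<Sum>l\<in>UNIV. \<Sum>i\<in>UNIV. \<Sum>j\<in>UNIV. X $ i * Y $ j * W $ l * ?d i j l) +
      (\<Sum>l\<in>UNIV. \<Sum>i\<in>UNIV. \<Sum>j\<in>UNIV. Y $ j * X $ i * W $ l * ?d j i l) -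
      (\<Sum>l\<in>UNIV. \<Sum>i\<in>UNIV. \<Sum>j\<in>UNIV. W $ l * X $ i * Y $ j * ?d l i j)"
    unfolding sum.distrib[symmetric] sum_subtractf[symmetric] c_def
    by (intro sum.cong refl) (simp add: algebra_simps)
  also have "(\<Sum>l\<in>UNIV. \<Sum>i\<in>UNIV. \<Sum>j\<in>UNIV. X $ i * Y $ j * W $ l * ?d i j l) =
      (\<Sum>i\<in>UNIV. \<Sum>l\<in>UNIV. \<Sum>j\<in>UNIV. X $ i * Y $ j * W $ l * ?d i j l)"
    by (rule sum.swap)
  also have "\<dots> = metric_derivative g z X Y W"
    unfolding metric_derivative_expand[OF g z] by (intro sum.cong refl sum.swap)
  also have "(\<Sum>l\<in>UNIV. \<Sum>i\<in>UNIV. \<Sum>j\<in>UNIV. Y $ j * X $ i * W $ l * ?d j i l) =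
      (\<Sum>l\<in>UNIV. \<Sum>j\<in>UNIV. \<Sum>i\<in>UNIV. Y $ j * X $ i * W $ l * ?d j i l)"
    by (intro sum.cong refl sum.swap)
  also have "\<dots> = (\<Sum>j\<in>UNIV. \<Sum>l\<in>UNIV. \<Sum>i\<in>UNIV. Y $ j * X $ i * W $ l * ?d j i l)"
    by (rule sum.swap)
  also have "\<dots> = metric_derivative g z Y X W"
    unfolding metric_derivative_expand[OF g z] by (intro sum.cong refl sum.swap)
  also have "(\<Sum>l\<in>UNIV. \<Sum>i\<in>UNIV. \<Sum>j\<in>UNIV. W $ l * X $ i * Y $ j * ?d l i j) =
      metric_derivative g z W X Y"
    unfolding metric_derivative_expand[OF g z] ..
  finally show ?thesis .
qed

lemma bilinear_connection_term: "bilinear (connection_term g z)"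
  unfolding bilinear_def
  by (intro conjI allI linearI)
    (simp_all add: connection_term_def vec_eq_iff algebra_simps sum.distrib sum_distrib_left)

section \<open>Mean curvature of a parametrized hypersurface\<close>

lemma positive_form_pullback:
  fixes D :: "real^'m \<Rightarrow> real^'n"
  assumes h: "positive_form h" and D: "linear D" "inj D"
  shows "positive_form (\<lambda>a b. h (D a) (D b))"
  unfolding positive_form_def bilinear_def
proof (intro conjI allI impI linearI)
  show "h (D v) (D w) = h (D w) (D v)" for v w
    by (rule positive_formD(2)[OF h])
  show "0 < h (D v) (D v)" if "v \<noteq> 0" for v
    using positive_formD(3)[OF h] D that linear_injective_0 by blast
qed (simp_all add: linear_add[OF D(1)] linear_cmul[OF D(1)] bilinear_ladd[OF positive_formD(1)[OF h]]
  bilinear_radd[OF positive_formD(1)[OF h]] bilinear_lmul[OF positive_formD(1)[OF h]]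
  bilinear_rmul[OF positive_formD(1)[OF h]])

text \<open>The tangential part is the vector that represents the functional \<open>g (F u) v\<close> on the tangent space,
  so the normal part exists; it is unique because the tangent space meets its orthogonal complement
  only in zero. A normal vector does not see the tangential part.\<close>

lemma inner_normal_part:
  fixes F :: "real^'m \<Rightarrow> real^'n"
  assumes h: "positive_form (g (F u))" and D: "linear (differential F u)" "inj (differential F u)"
    and \<nu>: "is_normal g F u \<nu>"
  shows "g (F u) (normal_part g F u v) \<nu> = g (F u) v \<nu>"
proof -
  note bil = positive_formD(1)[OF h]
  have "linear (\<lambda>b. g (F u) v (differential F u b))"
    using linear_compose[OF D(1), of "g (F u) v"] bil by (simp add: bilinear_def comp_def)
  then obtain t where t: "g (F u) (differential F u t) (differential F u b) =
      g (F u) v (differential F u b)" for b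
    using positive_form_represent[OF positive_form_pullback[OF h D]] by metis
  \<comment> \<open>The normal part is \<open>v\<close> minus the tangent vector with parameter \<open>t\<close>.\<close>
  have "\<exists>!w. is_normal g F u w \<and> v - w \<in> range (differential F u)"
  proof (rule ex1I)
    show "is_normal g F u (v - differential F u t) \<and>
        v - (v - differential F u t) \<in> range (differential F u)"
      by (simp add: is_normal_def bilinear_lsub[OF bil] t)
  next
    fix w assume w: "is_normal g F u w \<and> v - w \<in> range (differential F u)"
    then obtain s where s: "v - w = differential F u s" by blast
    have "g (F u) (differential F u s) (differential F u b) =
        g (F u) (differential F u t) (differential F u b)" for b
      using w by (simp add: s[symmetric] t bilinear_lsub[OF bil] is_normal_def)
    then have "s = t"
      by (rule positive_form_eqI[OF positive_form_pullback[OF h D]])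
    then show "w = v - differential F u t"
      using s by (simp add: algebra_simps)
  qed
  then have "is_normal g F u (normal_part g F u v) \<and>
      v - normal_part g F u v \<in> range (differential F u)"
    unfolding normal_part_def by (rule theI')
  then obtain s where "v - normal_part g F u v = differential F u s" by blast
  then have "g (F u) \<nu> (v - normal_part g F u v) = 0"
    using \<nu> by (simp add: is_normal_def)
  then show ?thesis
    by (simp add: bilinear_rsub[OF bil] positive_formD(2)[OF h, of _ \<nu>])
qed

text \<open>Bilinearity in \<open>b\<close> has to be transported through the derivative in \<open>u\<close>: the differentials at all
  points near \<open>u\<close> are linear in \<open>b\<close>, hence so is their derivative.\<close>

lemma smooth_on_second_differential:
  fixes F :: "real^'m \<Rightarrow> real^'n"
  assumes V: "open V" and F: "smooth_on V F" and u: "u \<in> V"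
  shows "linear (differential F u)"
    and "bilinear (\<lambda>a b. differential (\<lambda>u. differential F u b) u a)"
proof -
  have C2: "Ck_on (Suc (Suc 0)) V F"
    using F by (auto simp: smooth_on_def)
  then show D: "linear (differential F u)"
    using has_derivative_linear[OF Ck_on_SucD(1)[OF _ u]] by blast
  have lin: "linear (differential F w)" if "w \<in> V" for w
    using has_derivative_linear[OF Ck_on_SucD(1)[OF C2 that]] .
  have D2: "((\<lambda>u. differential F u b) has_derivative differential (\<lambda>u. differential F u b) u) (at u)" for b
    by (rule Ck_on_SucD(1)[OF Ck_on_SucD(2)[OF C2] u])
  have add: "differential (\<lambda>u. differential F u (b + b')) u =
      (\<lambda>a. differential (\<lambda>u. differential F u b) u a + differential (\<lambda>u. differential F u b') u a)"
    for b b'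
  proof (rule frechet_derivative_at[symmetric])
    show "((\<lambda>u. differential F u (b + b')) has_derivative
        (\<lambda>a. differential (\<lambda>u. differential F u b) u a + differential (\<lambda>u. differential F u b') u a)) (at u)"
      by (rule has_derivative_transform_within_open[OF has_derivative_add[OF D2 D2] V u])
        (simp add: linear_add[OF lin])
  qed
  have scale: "differential (\<lambda>u. differential F u (r *\<^sub>R b)) u =
      (\<lambda>a. r *\<^sub>R differential (\<lambda>u. differential F u b) u a)" for r b
  proof (rule frechet_derivative_at[symmetric])
    show "((\<lambda>u. differential F u (r *\<^sub>R b)) has_derivative
        (\<lambda>a. r *\<^sub>R differential (\<lambda>u. differential F u b) u a)) (at u)"
      by (rule has_derivative_transform_within_open[OF has_derivative_scaleR_right[OF D2] V u])
        (simp add: linear_cmul[OF lin])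
  qed
  show "bilinear (\<lambda>a b. differential (\<lambda>u. differential F u b) u a)"
    unfolding bilinear_def
    by (intro conjI allI has_derivative_linear[OF D2] linearI) (simp_all add: add scale)
qed

text \<open>By \<open>inner_normal_part\<close>, the projection to the normal space in \<open>second_fundamental_form\<close> can be
  omitted when the result is paired with a normal vector \<open>\<nu>\<close>.\<close>

definition scalar_second_form ::
  "'n metric_field \<Rightarrow> (real^'m \<Rightarrow> real^'n) \<Rightarrow> real^'m \<Rightarrow> real^'n \<Rightarrow> real^'m \<Rightarrow> real^'m \<Rightarrow> real" where
  "scalar_second_form g F u \<nu> a b =
     g (F u) (covariant_derivative g F (\<lambda>u. differential F u b) u a) \<nu>"

lemma covariant_derivative_connection_term:
  "covariant_derivative g F Y u a =
     differential Y u a + connection_term g (F u) (differential F u a) (Y u)"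
  by (simp add: covariant_derivative_def connection_term_def)

lemma bilinear_scalar_second_form:
  fixes F :: "real^'m \<Rightarrow> real^'n"
  assumes h: "positive_form (g (F u))" and V: "open V" and F: "smooth_on V F" and u: "u \<in> V"
  shows "bilinear (scalar_second_form g F u \<nu>)"
proof -
  note bil = positive_formD(1)[OF h]
  note D = smooth_on_second_differential[OF V F u]
  note C = bilinear_connection_term[of g "F u"]
  show ?thesis
    unfolding bilinear_def
    by (intro conjI allI linearI)
      (simp_all add: scalar_second_form_def covariant_derivative_connection_term
        linear_add[OF D(1)] linear_cmul[OF D(1)]
        bilinear_ladd[OF D(2)] bilinear_radd[OF D(2)] bilinear_lmul[OF D(2)] bilinear_rmul[OF D(2)]
        bilinear_ladd[OF C] bilinear_radd[OF C] bilinear_lmul[OF C] bilinear_rmul[OF C]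
        bilinear_ladd[OF bil] bilinear_lmul[OF bil] algebra_simps)
qed

lemma scalar_second_form_diagonal:
  fixes F :: "real^'m \<Rightarrow> real^'n"
  assumes g: "riemannian_metric_on U g" and z: "F u \<in> U"
  shows "scalar_second_form g F u \<nu> a a =
    g (F u) (differential (\<lambda>u. differential F u a) u a) \<nu> +
    metric_derivative g (F u) (differential F u a) (differential F u a) \<nu> -
    metric_derivative g (F u) \<nu> (differential F u a) (differential F u a) / 2"
  by (simp add: scalar_second_form_def covariant_derivative_connection_term
      bilinear_ladd[OF positive_formD(1)[OF riemannian_metric_onD(2)[OF g z]]]
      connection_term_koszul[OF g z] field_simps)

text \<open>The induced metric is the pull-back of the ambient one by the differential; with respect to it the
  shape operator represents the scalar second fundamental form, and \<open>trace_orthogonal_frame\<close> applies.\<close>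

lemma mean_curvature_orthogonal_frame:
  fixes T :: "3 \<Rightarrow> real^3"
  assumes h: "positive_form (g (F u))" and V: "open V" and F: "smooth_on V F" and u: "u \<in> V"
    and inj: "inj (differential F u)" and \<nu>: "is_normal g F u \<nu>"
    and T: "\<And>i. T i \<noteq> 0"
      "\<And>i j. i \<noteq> j \<Longrightarrow> g (F u) (differential F u (T i)) (differential F u (T j)) = 0"
  shows "mean_curvature g F u \<nu> = (1 / 3) * (\<Sum>i\<in>UNIV. scalar_second_form g F u \<nu> (T i) (T i) /
    g (F u) (differential F u (T i)) (differential F u (T i)))"
proof -
  note lin = smooth_on_second_differential(1)[OF V F u]
  note pull = positive_form_pullback[OF h lin inj]
  let ?A = "shape_operator g F u \<nu>"
  have "shape_operator g F u \<nu> = (THE A. linear A \<and> (\<forall>a b.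
      g (F u) (differential F u (A a)) (differential F u b) = scalar_second_form g F u \<nu> a b))"
    by (simp add: shape_operator_def second_fundamental_form_def scalar_second_form_def
        inner_normal_part[OF h lin inj \<nu>])
  then have A: "linear ?A"
      "\<forall>a b. g (F u) (differential F u (?A a)) (differential F u b) = scalar_second_form g F u \<nu> a b"
    using theI'[OF positive_form_represent_bilinear[OF pull bilinear_scalar_second_form[of g F u, OF h V F u]]]
    by simp_all
  show ?thesis
    using trace_orthogonal_frame[OF pull A(1), of T] T by (simp add: mean_curvature_def A(2))
qed

section \<open>The metric of a third-order equation\<close>

lemma vector_4 [simp]:
  "(vector [a, b, c, d] :: ('a::zero)^4) $ 1 = a"
  "(vector [a, b, c, d] :: ('a::zero)^4) $ 2 = b"
  "(vector [a, b, c, d] :: ('a::zero)^4) $ 3 = c"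
  "(vector [a, b, c, d] :: ('a::zero)^4) $ 4 = d"
  by (simp_all add: vector_def)

text \<open>Reduces smoothness and derivatives of a map given by its four components to those of real
  functions.\<close>

lemma vector_4_axis:
  "(vector [a, b, c, d] :: real^4) = a *\<^sub>R axis 1 1 + b *\<^sub>R axis 2 1 + c *\<^sub>R axis 3 1 + d *\<^sub>R axis 4 1"
  by (simp add: vec_eq_iff forall_4 axis_def)

lemma ode_metric_eq:
  "ode_metric f z v w = v $ 1 * w $ 1 +
     (v $ 2 - z $ 3 * v $ 1) * (w $ 2 - z $ 3 * w $ 1) +
     (v $ 3 - z $ 4 * v $ 1) * (w $ 3 - z $ 4 * w $ 1) +
     (v $ 4 - f (z $ 1) (z $ 2) (z $ 3) (z $ 4) * v $ 1) *
     (w $ 4 - f (z $ 1) (z $ 2) (z $ 3) (z $ 4) * w $ 1)"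
  by (simp add: ode_metric_def ode_coframe_def sum_4)

lemma riemannian_metric_on_ode_metric:
  assumes U: "open U" and f: "smooth_on U (\<lambda>z. f (z $ 1) (z $ 2) (z $ 3) (z $ 4))"
  shows "riemannian_metric_on U (ode_metric f)"
  unfolding riemannian_metric_on_def
proof (intro conjI ballI allI impI U)
  fix z
  show "bilinear (ode_metric f z)"
    unfolding bilinear_def by (intro conjI allI linearI) (simp_all add: ode_metric_eq algebra_simps)
  show "ode_metric f z v w = ode_metric f z w v" for v w
    by (simp add: ode_metric_eq mult.commute)
  show "0 < ode_metric f z v v" if "v \<noteq> 0" for v
  proof (rule ccontr)
    assume "\<not> 0 < ode_metric f z v v"
    then have "v $ 1 * v $ 1 = 0 \<and> (v $ 2 - z $ 3 * v $ 1) * (v $ 2 - z $ 3 * v $ 1) = 0 \<and>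
        (v $ 3 - z $ 4 * v $ 1) * (v $ 3 - z $ 4 * v $ 1) = 0 \<and>
        (v $ 4 - f (z $ 1) (z $ 2) (z $ 3) (z $ 4) * v $ 1) *
        (v $ 4 - f (z $ 1) (z $ 2) (z $ 3) (z $ 4) * v $ 1) = 0"
      unfolding ode_metric_eq
      using zero_le_square[of "v $ 1"] zero_le_square[of "v $ 2 - z $ 3 * v $ 1"]
        zero_le_square[of "v $ 3 - z $ 4 * v $ 1"]
        zero_le_square[of "v $ 4 - f (z $ 1) (z $ 2) (z $ 3) (z $ 4) * v $ 1"]
      by linarith
    then have "v = 0"
      by (simp add: vec_eq_iff forall_4)
    with that show False by simp
  qed
next
  fix v w :: "real^4"
  have coord: "Ck_on k U (\<lambda>z. z $ i)" for k i
    by (rule Ck_on_linear[OF U bounded_linear_vec_nth])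
  have f': "Ck_on k U (\<lambda>z. f (z $ 1) (z $ 2) (z $ 3) (z $ 4))" for k
    using f by (simp add: smooth_on_def)
  show "smooth_on U (\<lambda>z. ode_metric f z v w)"
    unfolding smooth_on_def ode_metric_eq
    by (intro allI Ck_on_add Ck_on_mult Ck_on_diff Ck_on_const coord f' U)
qed

text \<open>The product rule, applied to the sum of products of coframe components. The derivatives in direction
  \<open>X\<close> of \<open>\<omega>\<^sup>2 (Y)\<close>, \<open>\<omega>\<^sup>3 (Y)\<close>, \<open>\<omega>\<^sup>4 (Y)\<close> for constant \<open>Y\<close> are \<open>- dp (X) dx (Y)\<close>, \<open>- dq (X) dx (Y)\<close>,
  \<open>- df (X) dx (Y)\<close>, and \<open>\<omega>\<^sup>1\<close> is constant.\<close>

lemma metric_derivative_ode_metric: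
  assumes f: "((\<lambda>z. f (z $ 1) (z $ 2) (z $ 3) (z $ 4)) has_derivative df) (at z)"
  shows "metric_derivative (ode_metric f) z X Y W = (let \<theta> = ode_coframe f z in
     - X $ 3 * (Y $ 1 * \<theta> W $ 2 + \<theta> Y $ 2 * W $ 1)
     - X $ 4 * (Y $ 1 * \<theta> W $ 3 + \<theta> Y $ 3 * W $ 1)
     - df X * (Y $ 1 * \<theta> W $ 4 + \<theta> Y $ 4 * W $ 1))"
proof -
  have "((\<lambda>z. ode_metric f z Y W) has_derivative (\<lambda>X. let \<theta> = ode_coframe f z in
     - X $ 3 * (Y $ 1 * \<theta> W $ 2 + \<theta> Y $ 2 * W $ 1)
     - X $ 4 * (Y $ 1 * \<theta> W $ 3 + \<theta> Y $ 3 * W $ 1)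
     - df X * (Y $ 1 * \<theta> W $ 4 + \<theta> Y $ 4 * W $ 1))) (at z)"
    unfolding ode_metric_eq
    by (rule has_derivative_eq_rhs, (rule derivative_intros has_derivative_nth f)+)
      (simp add: fun_eq_iff ode_coframe_def Let_def algebra_simps)
  then show ?thesis
    unfolding metric_derivative_def by (rule fun_cong[OF frechet_derivative_at[symmetric]])
qed

section \<open>The hypersurface of a linear second-order equation\<close>

definition solution_map :: "(real \<Rightarrow> real) \<Rightarrow> (real \<Rightarrow> real) \<Rightarrow> real^3 \<Rightarrow> real^4" where
  "solution_map \<alpha> \<beta> u = vector [u $ 1, u $ 2, u $ 3, \<alpha> (u $ 1) * u $ 2 + \<beta> (u $ 1)]"

text \<open>The derivative of \<open>\<alpha> y + \<beta>\<close> along a solution of \<open>y'' = \<alpha> y + \<beta>\<close>, with \<open>p\<close> in place of \<open>y'\<close>. The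
  argument \<open>q\<close> makes it the right-hand side of a third-order equation.\<close>

definition prolonged_rhs ::
  "(real \<Rightarrow> real) \<Rightarrow> (real \<Rightarrow> real) \<Rightarrow> real \<Rightarrow> real \<Rightarrow> real \<Rightarrow> real \<Rightarrow> real" where
  "prolonged_rhs \<alpha> \<beta> x y p q = \<alpha> x * p + deriv \<alpha> x * y + deriv \<beta> x"

lemma smooth_on_prolonged_rhs:
  assumes "open I" and "smooth_on I \<alpha>" and "smooth_on I \<beta>"
  shows "smooth_on {z :: real^4. z $ 1 \<in> I} (\<lambda>z. prolonged_rhs \<alpha> \<beta> (z $ 1) (z $ 2) (z $ 3) (z $ 4))"
proof -
  let ?U = "{z :: real^4. z $ 1 \<in> I}"
  note U = open_coordinate[OF assms(1), of "1 :: 4"]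
  have coord: "Ck_on k ?U (\<lambda>z. z $ i)" for k i
    by (rule Ck_on_linear[OF U bounded_linear_vec_nth])
  have "Ck_on k ?U (\<lambda>z. \<alpha> (z $ 1))" "Ck_on k ?U (\<lambda>z. deriv \<alpha> (z $ 1))"
    "Ck_on k ?U (\<lambda>z. deriv \<beta> (z $ 1))" for k
    using smooth_on_coordinate[OF assms(1)] smooth_on_deriv[OF assms(1)] assms(2,3)
    unfolding smooth_on_def by blast+
  then show ?thesis
    unfolding smooth_on_def prolonged_rhs_def
    by (intro allI Ck_on_add Ck_on_mult coord U)
qed

lemma smooth_on_solution_map:
  assumes "open I" and "smooth_on I \<alpha>" and "smooth_on I \<beta>"
  shows "smooth_on {u. u $ 1 \<in> I} (solution_map \<alpha> \<beta>)"
proof -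
  let ?V = "{u :: real^3. u $ 1 \<in> I}"
  note V = open_coordinate[OF assms(1), of "1 :: 3"]
  have coord: "Ck_on k ?V (\<lambda>u. u $ i)" for k i
    by (rule Ck_on_linear[OF V bounded_linear_vec_nth])
  have \<alpha>\<beta>: "Ck_on k ?V (\<lambda>u. \<alpha> (u $ 1))" "Ck_on k ?V (\<lambda>u. \<beta> (u $ 1))" for k
    using smooth_on_coordinate[OF assms(1)] assms(2,3) unfolding smooth_on_def by blast+
  have "Ck_on k ?V (solution_map \<alpha> \<beta>)" for k
    unfolding solution_map_def[abs_def] vector_4_axis
    by (intro Ck_on_add Ck_on_linear_compose[OF V bounded_linear_scaleR_left] Ck_on_mult coord \<alpha>\<beta> V)
  then show ?thesis
    by (simp add: smooth_on_def)
qed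

lemma differential_solution_map:
  assumes "open I" and "smooth_on I \<alpha>" and "smooth_on I \<beta>" and "u $ 1 \<in> I"
  shows "differential (solution_map \<alpha> \<beta>) u a =
    vector [a $ 1, a $ 2, a $ 3, (deriv \<alpha> (u $ 1) * u $ 2 + deriv \<beta> (u $ 1)) * a $ 1 + \<alpha> (u $ 1) * a $ 2]"
proof -
  note \<alpha>\<beta> = has_derivative_coordinate[OF assms(2,4)] has_derivative_coordinate[OF assms(3,4)]
  have "(solution_map \<alpha> \<beta> has_derivative (\<lambda>a. vector [a $ 1, a $ 2, a $ 3,
      (deriv \<alpha> (u $ 1) * u $ 2 + deriv \<beta> (u $ 1)) * a $ 1 + \<alpha> (u $ 1) * a $ 2])) (at u)"
    unfolding solution_map_def[abs_def] vector_4_axis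
    by (rule has_derivative_eq_rhs, (rule derivative_intros has_derivative_nth \<alpha>\<beta>)+)
      (simp add: fun_eq_iff algebra_simps)
  from fun_cong[OF frechet_derivative_at[OF this, symmetric]] show ?thesis .
qed

lemma second_differential_solution_map:
  assumes "open I" and "smooth_on I \<alpha>" and "smooth_on I \<beta>" and "u $ 1 \<in> I"
  shows "differential (\<lambda>u. differential (solution_map \<alpha> \<beta>) u b) u a =
    vector [0, 0, 0,
      (deriv (deriv \<alpha>) (u $ 1) * u $ 2 + deriv (deriv \<beta>) (u $ 1)) * a $ 1 * b $ 1 +
      deriv \<alpha> (u $ 1) * (a $ 2 * b $ 1 + a $ 1 * b $ 2)]"
    (is "_ = ?D a")
proof -
  note \<alpha>\<beta> = has_derivative_coordinate[OF assms(2,4)]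
    has_derivative_coordinate[OF smooth_on_deriv[OF assms(1,2)] assms(4)]
    has_derivative_coordinate[OF smooth_on_deriv[OF assms(1,3)] assms(4)]
  have "((\<lambda>u. vector [b $ 1, b $ 2, b $ 3,
      (deriv \<alpha> (u $ 1) * u $ 2 + deriv \<beta> (u $ 1)) * b $ 1 + \<alpha> (u $ 1) * b $ 2] :: real^4)
      has_derivative ?D) (at u)"
    unfolding vector_4_axis
    by (rule has_derivative_eq_rhs, (rule derivative_intros has_derivative_nth \<alpha>\<beta>)+)
      (simp add: fun_eq_iff algebra_simps)
  then have "((\<lambda>u. differential (solution_map \<alpha> \<beta>) u b) has_derivative ?D) (at u)"
    by (rule has_derivative_transform_within_open[OF _ open_coordinate[OF assms(1), of "1 :: 3"]])
      (use assms(4) in \<open>simp_all add: differential_solution_map[OF assms(1-3)]\<close>)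
  from fun_cong[OF frechet_derivative_at[OF this, symmetric]] show ?thesis .
qed

lemma has_derivative_prolonged_rhs:
  assumes "open I" and "smooth_on I \<alpha>" and "smooth_on I \<beta>" and "z $ 1 \<in> I"
  shows "((\<lambda>z :: real^4. prolonged_rhs \<alpha> \<beta> (z $ 1) (z $ 2) (z $ 3) (z $ 4)) has_derivative
    (\<lambda>v. (deriv \<alpha> (z $ 1) * z $ 3 + deriv (deriv \<alpha>) (z $ 1) * z $ 2 + deriv (deriv \<beta>) (z $ 1)) * v $ 1
      + deriv \<alpha> (z $ 1) * v $ 2 + \<alpha> (z $ 1) * v $ 3)) (at z)"
proof -
  note \<alpha>\<beta> = has_derivative_coordinate[OF assms(2,4)]
    has_derivative_coordinate[OF smooth_on_deriv[OF assms(1,2)] assms(4)]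
    has_derivative_coordinate[OF smooth_on_deriv[OF assms(1,3)] assms(4)]
  show ?thesis
    unfolding prolonged_rhs_def
    by (rule has_derivative_eq_rhs, (rule derivative_intros has_derivative_nth \<alpha>\<beta>)+)
      (simp add: fun_eq_iff algebra_simps)
qed

text \<open>The last component is \<open>\<alpha>\<close> times the second one: this is the relation \<open>\<omega>\<^sup>4 = \<alpha> \<omega>\<^sup>2\<close> on the hypersurface,
  and it holds because \<open>f\<close> cancels the derivative of \<open>\<alpha> y + \<beta>\<close> along solutions.\<close>

lemma coframe_differential_solution_map:
  assumes "open I" and "smooth_on I \<alpha>" and "smooth_on I \<beta>" and "u $ 1 \<in> I"
  shows "ode_coframe (prolonged_rhs \<alpha> \<beta>) (solution_map \<alpha> \<beta> u) (differential (solution_map \<alpha> \<beta>) u a) =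
    vector [a $ 1, a $ 2 - u $ 3 * a $ 1, a $ 3 - (\<alpha> (u $ 1) * u $ 2 + \<beta> (u $ 1)) * a $ 1,
      \<alpha> (u $ 1) * (a $ 2 - u $ 3 * a $ 1)]"
  by (simp add: ode_coframe_def differential_solution_map[OF assms] solution_map_def prolonged_rhs_def
      vec_eq_iff forall_4 algebra_simps)

text \<open>The differential of \<open>solution_map\<close> takes these vectors of the parameter space to \<open>e\<^sub>1\<close>,
  \<open>e\<^sub>2 + \<alpha> e\<^sub>4\<close> and \<open>e\<^sub>3\<close>.\<close>

definition solution_frame :: "(real \<Rightarrow> real) \<Rightarrow> (real \<Rightarrow> real) \<Rightarrow> real^3 \<Rightarrow> 3 \<Rightarrow> real^3" where
  "solution_frame \<alpha> \<beta> u i = (vector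
     [vector [1, u $ 3, \<alpha> (u $ 1) * u $ 2 + \<beta> (u $ 1)], vector [0, 1, 0], vector [0, 0, 1]]
     :: real^3^3) $ i"

lemma solution_frame_simps:
  "solution_frame \<alpha> \<beta> u 1 = vector [1, u $ 3, \<alpha> (u $ 1) * u $ 2 + \<beta> (u $ 1)]"
  "solution_frame \<alpha> \<beta> u 2 = vector [0, 1, 0]"
  "solution_frame \<alpha> \<beta> u 3 = vector [0, 0, 1]"
  by (simp_all add: solution_frame_def)

text \<open>Pairing with the three frame vectors gives the three linear equations for the components of a normal
  vector in the frame \<open>e\<^sub>1, \<dots>, e\<^sub>4\<close>.\<close>

lemma normal_solution_map:
  assumes "open I" and "smooth_on I \<alpha>" and "smooth_on I \<beta>" and "u $ 1 \<in> I"
    and \<nu>: "is_normal (ode_metric (prolonged_rhs \<alpha> \<beta>)) (solution_map \<alpha> \<beta>) u \<nu>"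
  shows "\<exists>c. ode_coframe (prolonged_rhs \<alpha> \<beta>) (solution_map \<alpha> \<beta> u) \<nu> = vector [0, - \<alpha> (u $ 1) * c, 0, c]"
proof -
  let ?n = "ode_coframe (prolonged_rhs \<alpha> \<beta>) (solution_map \<alpha> \<beta> u) \<nu>"
  have "?n $ 1 * a $ 1 + ?n $ 2 * (a $ 2 - u $ 3 * a $ 1) +
      ?n $ 3 * (a $ 3 - (\<alpha> (u $ 1) * u $ 2 + \<beta> (u $ 1)) * a $ 1) +
      ?n $ 4 * (\<alpha> (u $ 1) * (a $ 2 - u $ 3 * a $ 1)) = 0" for a :: "real^3"
    using \<nu> by (simp add: is_normal_def ode_metric_def sum_4 coframe_differential_solution_map[OF assms(1-4)])
  from this[of "solution_frame \<alpha> \<beta> u 1"] this[of "solution_frame \<alpha> \<beta> u 2"] this[of "solution_frame \<alpha> \<beta> u 3"]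
  have "?n $ 1 = 0" "?n $ 2 + \<alpha> (u $ 1) * ?n $ 4 = 0" "?n $ 3 = 0"
    by (simp_all add: solution_frame_simps mult.commute)
  then have "?n = vector [0, - \<alpha> (u $ 1) * ?n $ 4, 0, ?n $ 4]"
    by (simp add: vec_eq_iff forall_4)
  then show ?thesis ..
qed

text \<open>For the second and third frame vector every term carries a factor \<open>dx\<close> of a vector with \<open>dx = 0\<close>, so
  all terms vanish. Now consider \<open>e\<^sub>1\<close>, whose only nonzero coframe component is the first one, while
  that of \<open>\<nu>\<close> is zero. Let \<open>c\<close> be the \<open>e\<^sub>4\<close> component of \<open>\<nu>\<close>. The second derivative of the
  parametrization contributes \<open>c (\<alpha>'' y + \<beta>'' + 2 \<alpha>' p)\<close>, the change of \<open>\<omega>\<^sup>4\<close> contributes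
  \<open>- c df (e\<^sub>1) = - c (\<alpha>'' y + \<beta>'' + 2 \<alpha>' p + \<alpha> q)\<close>, and the change of \<open>\<omega>\<^sup>2\<close>, weighted with the
  \<open>e\<^sub>2\<close> component \<open>- \<alpha> c\<close> of \<open>\<nu>\<close>, contributes \<open>c \<alpha> q\<close>. The sum is zero.\<close>

lemma solution_frame_asymptotic:
  assumes "open I" and "smooth_on I \<alpha>" and "smooth_on I \<beta>" and "u $ 1 \<in> I"
    and \<nu>: "is_normal (ode_metric (prolonged_rhs \<alpha> \<beta>)) (solution_map \<alpha> \<beta>) u \<nu>"
  shows "scalar_second_form (ode_metric (prolonged_rhs \<alpha> \<beta>)) (solution_map \<alpha> \<beta>) u \<nu>
    (solution_frame \<alpha> \<beta> u i) (solution_frame \<alpha> \<beta> u i) = 0"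
proof -
  let ?f = "prolonged_rhs \<alpha> \<beta>" and ?F = "solution_map \<alpha> \<beta>"
  obtain c where c: "ode_coframe ?f (?F u) \<nu> = vector [0, - \<alpha> (u $ 1) * c, 0, c]"
    using normal_solution_map[OF assms] by blast
  have F: "?F u $ 1 = u $ 1" "?F u $ 2 = u $ 2" "?F u $ 3 = u $ 3"
      "?F u $ 4 = \<alpha> (u $ 1) * u $ 2 + \<beta> (u $ 1)"
    by (simp_all add: solution_map_def)
  have \<nu>1: "\<nu> $ 1 = 0"
    using c by (simp add: ode_coframe_def vec_eq_iff forall_4)
  have \<nu>: "\<nu> $ 2 = - \<alpha> (u $ 1) * c" "\<nu> $ 3 = 0" "\<nu> $ 4 = c"
    using c by (simp_all add: \<nu>1 ode_coframe_def vec_eq_iff forall_4)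
  have z: "?F u $ 1 \<in> I"
    using assms(4) by (simp add: F)
  then have zU: "?F u \<in> {z. z $ 1 \<in> I}"
    by simp
  note g = riemannian_metric_on_ode_metric[OF open_coordinate[OF assms(1)] smooth_on_prolonged_rhs[OF assms(1-3)]]
  note dg = metric_derivative_ode_metric[OF has_derivative_prolonged_rhs[OF assms(1-3) z]]
  have "i = 1 \<or> i = 2 \<or> i = 3" by (rule exhaust_3)
  then show ?thesis
    unfolding scalar_second_form_diagonal[of _ _ ?F u, OF g zU] dg Let_def
      coframe_differential_solution_map[OF assms(1-4)] second_differential_solution_map[OF assms(1-4)]
      c F differential_solution_map[OF assms(1-4)]
    by (auto simp: ode_metric_def sum_4 c solution_frame_simps \<nu>1 \<nu> F ode_coframe_def
        prolonged_rhs_def algebra_simps)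
qed

lemma mean_curvature_solution_map:
  assumes "open I" and "smooth_on I \<alpha>" and "smooth_on I \<beta>" and "u $ 1 \<in> I"
    and inj: "inj (differential (solution_map \<alpha> \<beta>) u)"
    and \<nu>: "is_normal (ode_metric (prolonged_rhs \<alpha> \<beta>)) (solution_map \<alpha> \<beta>) u \<nu>"
  shows "mean_curvature (ode_metric (prolonged_rhs \<alpha> \<beta>)) (solution_map \<alpha> \<beta>) u \<nu> = 0"
proof -
  let ?g = "ode_metric (prolonged_rhs \<alpha> \<beta>)" and ?F = "solution_map \<alpha> \<beta>"
  let ?T = "solution_frame \<alpha> \<beta> u"
  note g = riemannian_metric_on_ode_metric[OF open_coordinate[OF assms(1)] smooth_on_prolonged_rhs[OF assms(1-3)]]
  have h: "positive_form (?g (?F u))"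
    by (rule riemannian_metric_onD(2)[OF g]) (simp add: solution_map_def assms(4))
  have "?T i \<noteq> 0" for i
    using exhaust_3[of i] by (auto simp: solution_frame_simps vec_eq_iff forall_3)
  moreover have "?g (?F u) (differential ?F u (?T i)) (differential ?F u (?T j)) = 0" if "i \<noteq> j" for i j
    using that exhaust_3[of i] exhaust_3[of j]
    by (auto simp: ode_metric_def sum_4 coframe_differential_solution_map[OF assms(1-4)] solution_frame_simps)
  ultimately have "mean_curvature ?g ?F u \<nu> = (1 / 3) * (\<Sum>i\<in>UNIV. scalar_second_form ?g ?F u \<nu> (?T i) (?T i) /
      ?g (?F u) (differential ?F u (?T i)) (differential ?F u (?T i)))"
    using assms(4)
    by (intro mean_curvature_orthogonal_frame[of ?g ?F, OF h open_coordinate[OF assms(1)]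
          smooth_on_solution_map[OF assms(1-3)] _ inj \<nu>]) auto
  then show ?thesis
    by (simp add: solution_frame_asymptotic[OF assms(1-4) \<nu>])
qed

text \<open>The image is the graph of \<open>q\<close> over the \<open>(x, y, p)\<close> space, and the projection to that space is a
  continuous inverse.\<close>

lemma local_parametrization_solution_map:
  assumes "open I" and "smooth_on I \<alpha>" and "smooth_on I \<beta>"
  shows "local_parametrization (solution_map \<alpha> \<beta> ` {u. u $ 1 \<in> I}) {u. u $ 1 \<in> I} (solution_map \<alpha> \<beta>)"
  unfolding local_parametrization_def
proof (intro conjI ballI)
  let ?V = "{u :: real^3. u $ 1 \<in> I}" and ?F = "solution_map \<alpha> \<beta>"
  show "open ?V" by (rule open_coordinate[OF assms(1)])
  show smooth: "smooth_on ?V ?F" by (rule smooth_on_solution_map[OF assms])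
  show "inj (differential ?F u)" if "u \<in> ?V" for u
  proof (rule injI)
    fix a b
    assume "differential ?F u a = differential ?F u b"
    with that show "a = b"
      by (simp add: differential_solution_map[OF assms] vec_eq_iff forall_3 forall_4)
  qed
  show "openin (top_of_set (?F ` ?V)) (?F ` ?V)"
    by (rule openin_subtopology_self)
  have cont: "continuous_on ?V ?F"
    using smooth Ck_on_imp_continuous_on by (auto simp: smooth_on_def)
  have "homeomorphism ?V (?F ` ?V) ?F (\<lambda>z. z $ 1 *\<^sub>R axis 1 1 + z $ 2 *\<^sub>R axis 2 1 + z $ 3 *\<^sub>R axis 3 1)"
    by (rule homeomorphismI[OF cont])
      (auto simp: solution_map_def vec_eq_iff forall_3 axis_def intro!: continuous_intros)
  then show "\<exists>G. homeomorphism ?V (?F ` ?V) ?F G" by blast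
qed

theorem mainTheorem2:
  fixes \<alpha> \<beta> :: "real \<Rightarrow> real" and I :: "real set"
  assumes "open I" and "is_interval I"
    and "smooth_on I \<alpha>" and "smooth_on I \<beta>"
  shows "minimal_hypersurface
           {z :: real^4. z $ 1 \<in> I}
           (ode_metric (\<lambda>x y p q. \<alpha> x * p + deriv \<alpha> x * y + deriv \<beta> x))
           ((\<lambda>u :: real^3. vector [u $ 1, u $ 2, u $ 3, \<alpha> (u $ 1) * u $ 2 + \<beta> (u $ 1)]) `
              {u. u $ 1 \<in> I})"
proof -
  let ?U = "{z :: real^4. z $ 1 \<in> I}" and ?V = "{u :: real^3. u $ 1 \<in> I}"
  let ?g = "ode_metric (prolonged_rhs \<alpha> \<beta>)" and ?F = "solution_map \<alpha> \<beta>"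
  note sm = assms(1,3,4)
  note lp = local_parametrization_solution_map[OF sm]
  have "minimal_hypersurface ?U ?g (?F ` ?V)"
    unfolding minimal_hypersurface_def
  proof (intro conjI ballI)
    show "riemannian_metric_on ?U ?g"
      by (rule riemannian_metric_on_ode_metric[OF open_coordinate[OF assms(1)] smooth_on_prolonged_rhs[OF sm]])
    show "?F ` ?V \<subseteq> ?U"
      by (auto simp: solution_map_def)
    have "mean_curvature ?g ?F u \<nu> = 0" if "u \<in> ?V" "unit_normal ?g ?F u \<nu>" for u \<nu>
      using that lp
      by (intro mean_curvature_solution_map[OF sm]) (auto simp: local_parametrization_def unit_normal_def)
    then show "\<exists>V F. local_parametrization (?F ` ?V) V F \<and> z \<in> F ` V \<and>
        (\<forall>u\<in>V. \<forall>\<nu>. unit_normal ?g F u \<nu> \<longrightarrow> mean_curvature ?g F u \<nu> = 0)"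
      if "z \<in> ?F ` ?V" for z
      using lp that by blast
  qed
  then show ?thesis
    by (simp add: solution_map_def[abs_def] prolonged_rhs_def[abs_def])
qed

end
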